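(* Let $a,b,c,\delta$ be strictly positive integers such that $c^2-\delta b^2=\pm1$ (i.e. $b$ and $c$ solve the Pell–Fermat equation for one of the two signs), $a$ and $c$ are coprime, and $a<c$. Let $[0,a_1,a_2,\dots,a_{n-1},a_n]$ be the continued fraction expansion of the rational number $\frac{a}{c}$. Then one of the following two equalities holds: $$\frac{c-a+b\sqrt{\delta}}{c}=[\overline{1,1,a_1-1,a_2,a_3,\dots,a_{n-1},a_n,1,1,a_n-1,a_{n-1},a_{n-2},\dots,a_2,a_1}]$$ or $$\frac{c-a+b\sqrt{\delta}}{c}=[\overline{1,1,a_1-1,a_2,a_3,\dots,a_{n-1},a_n-1,1,1,a_n,a_{n-1},a_{n-2},\dots,a_2,a_1}].$$
   Context: $[a_0,a_1,\dots,a_n]=a_0+1/(a_1+1/(\cdots+1/a_n))$, and $[\overline{u_1,\dots,u_p}]$ denotes the real number whose continued fraction expansion is purely periodic with period $(u_1,\dots,u_p)$. If some of the integers in the displayed periods are zero (which happens if $a_1=1$ or $a_n=1$), each (cyclically consecutive) triple $x,0,y$ is to be replaced by the single entry $x+y$ so as to obtain a genuine continued fraction. When $n=1$, the first period is to be read as $1,1,a_1-1,1,1,a_1-1$ and the second as $1,1,a_1-2,1,1,a_1$. *)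

theory Defs
  imports Complex_Main
begin

fun cfrac_val :: "nat list \<Rightarrow> real" where
  "cfrac_val [] = 0"
| "cfrac_val [x] = real x"
| "cfrac_val (x # y # zs) = real x + 1 / cfrac_val (y # zs)"

text \<open>The entries of the period are required to be positive, so that this is a genuine
  (regular) continued fraction expansion of \<open>x\<close>.\<close>

definition has_periodic_cfrac :: "real \<Rightarrow> nat list \<Rightarrow> bool" where
  "has_periodic_cfrac x us \<longleftrightarrow>
     us \<noteq> [] \<and> (\<forall>u \<in> set us. 0 < u) \<and>
     (\<lambda>k. cfrac_val (map (\<lambda>i. us ! (i mod length us)) [0..<Suc k])) \<longlonglongrightarrow> x"

text \<open>Replaces triples \<open>x, 0, y\<close> by \<open>x + y\<close> until none is left, so that for instance
  \<open>x, 0, 0, y\<close> becomes \<open>x, y\<close>. A zero at either end of the list is not removed: the periods below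
  begin and end with a positive entry (for \<open>0 < a < c\<close>), hence no triple wraps around.\<close>

fun absorb_zeros :: "nat list \<Rightarrow> nat list" where
  "absorb_zeros (x # 0 # y # zs) = absorb_zeros ((x + y) # zs)"
| "absorb_zeros (x # xs) = x # absorb_zeros xs"
| "absorb_zeros [] = []"

definition dec_first :: "nat list \<Rightarrow> nat list" where
  "dec_first xs = (hd xs - 1) # tl xs"

definition dec_last :: "nat list \<Rightarrow> nat list" where
  "dec_last xs = butlast xs @ [last xs - 1]"

text \<open>The argument is the list \<open>a\<^sub>1, \<dots>, a\<^sub>n\<close>. For \<open>n = 1\<close> the two periods are
  \<open>1, 1, a\<^sub>1 - 1, 1, 1, a\<^sub>1 - 1\<close> and \<open>1, 1, a\<^sub>1 - 2, 1, 1, a\<^sub>1\<close>.\<close>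

definition period1 :: "nat list \<Rightarrow> nat list" where
  "period1 xs = [1, 1] @ dec_first xs @ [1, 1] @ dec_first (rev xs)"

definition period2 :: "nat list \<Rightarrow> nat list" where
  "period2 xs = [1, 1] @ dec_last (dec_first xs) @ [1, 1] @ rev xs"

end

theory Submission imports Defs begin

text \<open>Write \<open>M(u) = (u 1; 1 0)\<close> and \<open>P = M(a\<^sub>1) \<cdots> M(a\<^sub>n)\<close>. Coprimality forces the first column of
  \<open>P\<close> to be \<open>(c, a)\<close>. Transposition reverses a word, and lowering its first entry multiplies by
  \<open>(1 -1; 0 1)\<close> on the left. So with \<open>V = (2 -1; 1 0)\<close> the two periods have the matrices
  \<open>V P V P\<^sup>T\<close> and \<open>V P V\<^sup>T P\<^sup>T\<close>. The symmetric part of \<open>P V P\<^sup>T\<close> depends only on \<open>c\<close> and \<open>a\<close>,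
  the antisymmetric part only on \<open>det P = \<plusminus>1\<close>. Hence the fixed points of the two matrices are the
  roots of \<open>c\<^sup>2x\<^sup>2 - 2c(c - a)x + a\<^sup>2 - 2ac + e = 0\<close> for \<open>e = det P\<close> and for \<open>e = - det P\<close>, and
  the given number is a root for \<open>e = c\<^sup>2 - \<delta>b\<^sup>2\<close>. Absorbing zeros does not change the Moebius map
  of a word, and a positive fixed point of a word with positive entries is the value of the
  periodic continued fraction, because two steps contract distances by a factor 4.\<close>

section \<open>Words as Moebius maps\<close>

text \<open>The word \<open>us\<close> followed by a complete quotient \<open>y\<close>: the Moebius
  map attached to the word.\<close>

definition cfrac_tail :: "nat list \<Rightarrow> real \<Rightarrow> real" where
  "cfrac_tail us y = foldr (\<lambda>u z. real u + 1 / z) us y"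

lemma cfrac_tail_simps [simp]:
  "cfrac_tail [] y = y"
  "cfrac_tail (u # us) y = real u + 1 / cfrac_tail us y"
  by (simp_all add: cfrac_tail_def)

lemma cfrac_tail_pos: "0 < y \<Longrightarrow> 0 < cfrac_tail us y"
  by (induction us) (auto intro: add_nonneg_pos)

text \<open>Across a zero entry two inversions cancel: x + 1/(0 + 1/z) = x + z. This also holds for
  z = 0, since 1/0 = 0.\<close>

lemma cfrac_tail_absorb_zeros: "cfrac_tail (absorb_zeros us) y = cfrac_tail us y"
  by (induction us rule: absorb_zeros.induct) simp_all

lemma absorb_zeros_eq_Nil_iff [simp]: "absorb_zeros us = [] \<longleftrightarrow> us = []"
  by (induction us rule: absorb_zeros.induct) simp_all

text \<open>Merging keeps the head positive, and a zero right after the head is merged unless it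
  ends the list.\<close>

lemma absorb_zeros_pos:
  assumes "us \<noteq> []" "0 < hd us" "0 < last us"
  shows "\<forall>u \<in> set (absorb_zeros us). 0 < u"
  using assms
proof (induction us rule: absorb_zeros.induct)
  case (1 x y zs)
  have "(x + y) # zs \<noteq> []" "0 < hd ((x + y) # zs)" "0 < last ((x + y) # zs)"
    using "1.prems" by (simp_all split: if_splits)
  from "1.IH"[OF this] show ?case
    by (simp only: absorb_zeros.simps)
qed (simp_all split: if_splits)

text \<open>The quadruple \<open>(p, q, r, s)\<close> stands for the matrix with rows \<open>(p, q)\<close> and \<open>(r, s)\<close>.\<close>

type_synonym mat2 = "int \<times> int \<times> int \<times> int"

fun mult2 :: "mat2 \<Rightarrow> mat2 \<Rightarrow> mat2" where
  "mult2 (p, q, r, s) (p', q', r', s') =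
     (p * p' + q * r', p * q' + q * s', r * p' + s * r', r * q' + s * s')"

fun transpose2 :: "mat2 \<Rightarrow> mat2" where
  "transpose2 (p, q, r, s) = (p, r, q, s)"

fun det2 :: "mat2 \<Rightarrow> int" where
  "det2 (p, q, r, s) = p * s - q * r"

fun cfrac_mat :: "nat list \<Rightarrow> mat2" where
  "cfrac_mat [] = (1, 0, 0, 1)"
| "cfrac_mat (u # us) = mult2 (int u, 1, 1, 0) (cfrac_mat us)"

lemma mult2_assoc: "mult2 (mult2 A B) C = mult2 A (mult2 B C)"
  by (cases A; cases B; cases C) (simp add: algebra_simps)

lemma mult2_one [simp]: "mult2 (1, 0, 0, 1) A = A"
  by (cases A) simp

lemma transpose2_mult2: "transpose2 (mult2 A B) = mult2 (transpose2 B) (transpose2 A)"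
  by (cases A; cases B) (simp add: algebra_simps)

lemma det2_mult2: "det2 (mult2 A B) = det2 A * det2 B"
  by (cases A; cases B) (simp add: algebra_simps)

lemma cfrac_mat_append: "cfrac_mat (us @ vs) = mult2 (cfrac_mat us) (cfrac_mat vs)"
  by (induction us) (simp_all add: mult2_assoc)

lemma cfrac_mat_rev: "cfrac_mat (rev us) = transpose2 (cfrac_mat us)"
  by (induction us) (simp_all add: cfrac_mat_append transpose2_mult2)

lemma det2_cfrac_mat: "det2 (cfrac_mat us) = (- 1) ^ length us"
  by (induction us) (simp_all add: det2_mult2)

lemma cfrac_mat_dec_first:
  assumes "us \<noteq> []" "0 < hd us"
  shows "cfrac_mat (dec_first us) = mult2 (1, - 1, 0, 1) (cfrac_mat us)"
proof -
  obtain v vs where us: "us = v # vs" using assms(1) by (cases us) auto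
  then show ?thesis
    using assms by (cases "cfrac_mat vs") (simp add: dec_first_def of_nat_diff algebra_simps)
qed

lemma cfrac_mat_dec_last:
  assumes "us \<noteq> []" "0 < last us"
  shows "cfrac_mat (dec_last us) = mult2 (cfrac_mat us) (1, 0, - 1, 1)"
proof -
  obtain v vs where us: "us = vs @ [v]" using assms(1) by (cases us rule: rev_cases) auto
  then show ?thesis
    using assms by (cases "cfrac_mat vs")
      (simp add: dec_last_def cfrac_mat_append of_nat_diff algebra_simps)
qed

lemma cfrac_tail_eq_mat:
  assumes "cfrac_mat us = (p, q, r, s)" "0 < y"
  shows "0 < of_int r * y + of_int s"
    and "cfrac_tail us y = (of_int p * y + of_int q) / (of_int r * y + of_int s)"
proof -
  \<comment> \<open>The numerator for a word is the denominator once an entry is prepended, so the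
    induction carries its sign as well.\<close>
  have "0 < of_int r * y + of_int s \<and> 0 < of_int p * y + of_int q \<and>
      cfrac_tail us y = (of_int p * y + of_int q) / (of_int r * y + of_int s)"
    using assms(1)
  proof (induction us arbitrary: p q r s)
    case Nil
    then show ?case using assms(2) by simp
  next
    case (Cons u us)
    obtain p' q' r' s' where m: "cfrac_mat us = (p', q', r', s')"
      by (metis prod_cases4)
    define N where "N = of_int p' * y + of_int q'"
    define D where "D = of_int r' * y + of_int s'"
    have "0 < D" "0 < N" "cfrac_tail us y = N / D"
      using Cons.IH[OF m] by (simp_all add: N_def D_def)
    moreover have "of_int p * y + of_int q = real u * N + D" "of_int r * y + of_int s = N"
      using Cons.prems m by (auto simp: N_def D_def algebra_simps)
    ultimately show ?case
      by (simp add: add_nonneg_pos add_divide_distrib)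
  qed
  then show "0 < of_int r * y + of_int s"
    and "cfrac_tail us y = (of_int p * y + of_int q) / (of_int r * y + of_int s)" by auto
qed

text \<open>Formally the case of an infinite complete quotient: only the first column of the matrix
  remains.\<close>

lemma cfrac_val_eq_mat:
  assumes "us \<noteq> []" "\<forall>u \<in> set us. 0 < u" "cfrac_mat us = (p, q, r, s)"
  shows "0 < p \<and> 0 < r \<and> cfrac_val us = of_int p / of_int r"
  using assms
proof (induction us arbitrary: p q r s rule: cfrac_val.induct)
  case (3 u v us)
  obtain p' q' r' s' where m: "cfrac_mat (v # us) = (p', q', r', s')"
    by (metis prod_cases4)
  have IH: "0 < p'" "0 < r'" "cfrac_val (v # us) = of_int p' / of_int r'"
    using "3.IH"[OF _ _ m] "3.prems"(2) by auto
  have "(p, q, r, s) = mult2 (int u, 1, 1, 0) (p', q', r', s')"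
    using "3.prems"(3) unfolding m[symmetric] by simp
  then have "p = int u * p' + r'" "r = p'" by simp_all
  then show ?case
    using IH by (simp add: add_nonneg_pos add_divide_distrib)
qed auto

section \<open>Periodic continued fractions\<close>

text \<open>Any positive solution \<open>X\<close> of the recursion for complete quotients is the
  limit of the convergents.\<close>

lemma cfrac_val_convergents:
  fixes u :: "nat \<Rightarrow> nat" and X :: "nat \<Rightarrow> real"
  assumes u: "\<And>k. 0 < u k" and X: "\<And>k. 0 < X k"
    and rec: "\<And>k. X k = real (u k) + 1 / X (Suc k)"
  shows "(\<lambda>k. cfrac_val (map u [0..<Suc k])) \<longlonglongrightarrow> X 0"
proof -
  define C where "C m k = cfrac_val (map u [m..<Suc (m + k)])" for m k
  have C0: "C m 0 = real (u m)" for m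
    by (simp add: C_def)
  have CS: "C m (Suc k) = real (u m) + 1 / C (Suc m) k" for m k
  proof -
    have "[m..<Suc (m + Suc k)] = m # Suc m # [Suc (Suc m)..<Suc (Suc m + k)]"
      "[Suc m..<Suc (Suc m + k)] = Suc m # [Suc (Suc m)..<Suc (Suc m + k)]"
      by (simp_all add: upt_conv_Cons)
    then show ?thesis by (simp add: C_def del: upt_Suc)
  qed
  have u1: "1 \<le> real (u m)" for m
    using u[of m] by linarith
  have X1: "1 \<le> X m" for m
    using u1[of m] rec[of m] X[of "Suc m"] by (smt (verit) divide_pos_pos)
  have C1: "1 \<le> C m k" for m k
  proof (induction k arbitrary: m)
    case 0
    show ?case by (simp add: C0 u Suc_leI)
  next
    case (Suc k)
    then have "0 < 1 / C (Suc m) k" by (smt (verit) divide_pos_pos)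
    then show ?case using u1[of m] CS[of m k] by linarith
  qed
  have step: "\<bar>(v + 1 / y) - (v + 1 / z)\<bar> = \<bar>y - z\<bar> / (y * z)"
    if "1 \<le> y" "1 \<le> z" for v y z :: real
  proof -
    have "(v + 1 / y) - (v + 1 / z) = (z - y) / (y * z)"
      using that by (simp add: field_simps)
    then show ?thesis using that by (simp add: abs_minus_commute)
  qed
  \<comment> \<open>A single step may contract by a factor close to 1, hence the two-step induction.
    The constant 2 is fitted to k = 1, where two numbers in (0, 1] are compared.\<close>
  have bound: "\<bar>C m k - X m\<bar> \<le> 2 * (1 / 2) ^ k" for m k
  proof (induction k arbitrary: m rule: induct_nat_012)
    case 0
    have "1 / X (Suc m) \<le> 1" "0 < 1 / X (Suc m)" using X1[of "Suc m"] by simp_all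
    then have "\<bar>C m 0 - X m\<bar> \<le> 2"
      using rec[of m] C0[of m] by linarith
    then show ?case by simp
  next
    case 1
    have "1 / X (Suc m) \<le> 1" "1 / X (Suc m) > 0" "1 / C (Suc m) 0 \<le> 1" "1 / C (Suc m) 0 > 0"
      using X1[of "Suc m"] C1[of "Suc m" 0] by simp_all
    then have "\<bar>C m (Suc 0) - X m\<bar> \<le> 1"
      using rec[of m] CS[of m 0] by linarith
    then show ?case by simp
  next
    case (ge2 k)
    define y where "y = C (Suc (Suc m)) k"
    define z where "z = X (Suc (Suc m))"
    define v where "v = real (u (Suc m))"
    have ge: "1 \<le> y" "1 \<le> z" "1 \<le> v"
      by (simp_all add: y_def z_def v_def C1 X1 u Suc_leI)
    have eqs: "C (Suc m) (Suc k) = v + 1 / y" "X (Suc m) = v + 1 / z"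
      by (simp_all add: y_def z_def v_def CS rec[symmetric])
    have "\<bar>C m (Suc (Suc k)) - X m\<bar> = \<bar>C (Suc m) (Suc k) - X (Suc m)\<bar> /
        (C (Suc m) (Suc k) * X (Suc m))"
      using CS[of m "Suc k"] rec[of m] step C1 X1 by metis
    also have "\<dots> = \<bar>y - z\<bar> / (y * z) / ((v + 1 / y) * (v + 1 / z))"
      using step[OF ge(1,2)] by (simp add: eqs)
    also have "\<dots> = \<bar>y - z\<bar> / ((v * y + 1) * (v * z + 1))"
      using ge by (simp add: field_simps)
    also have "\<dots> \<le> \<bar>y - z\<bar> / 4"
    proof (rule divide_left_mono)
      have "1 \<le> v * y" "1 \<le> v * z"
        using ge mult_mono[of 1 v 1 y] mult_mono[of 1 v 1 z] by auto
      then show "4 \<le> (v * y + 1) * (v * z + 1)"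
        using mult_mono[of 2 "v * y + 1" 2 "v * z + 1"] by auto
      then show "0 < (v * y + 1) * (v * z + 1) * 4" by linarith
    qed simp
    also have "\<dots> \<le> 2 * (1 / 2) ^ Suc (Suc k)"
      using ge2.IH(1)[of "Suc (Suc m)"] by (simp add: y_def z_def)
    finally show ?case .
  qed
  have "(\<lambda>k. 2 * (1 / 2) ^ k :: real) \<longlonglongrightarrow> 2 * 0"
    by (intro tendsto_mult tendsto_const LIMSEQ_power_zero) simp
  then have "(\<lambda>k. 2 * (1 / 2) ^ k :: real) \<longlonglongrightarrow> 0" by simp
  then have "(\<lambda>k. C 0 k - X 0) \<longlonglongrightarrow> 0"
    by (rule tendsto_0_le[where K = 1]) (use bound in simp)
  then have "(\<lambda>k. C 0 k) \<longlonglongrightarrow> X 0"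
    by (simp add: LIM_zero_iff)
  then show ?thesis by (simp add: C_def)
qed

lemma has_periodic_cfrac_fixpoint:
  assumes ne: "us \<noteq> []" and pos: "\<forall>u \<in> set us. 0 < u"
    and x: "0 < x" "cfrac_tail us x = x"
  shows "has_periodic_cfrac x us"
proof -
  define X where "X k = cfrac_tail (drop (k mod length us) us) x" for k
  have rec: "X k = real (us ! (k mod length us)) + 1 / X (Suc k)" for k
  proof -
    have lt: "k mod length us < length us" using ne by simp
    \<comment> \<open>At the end of a period the remaining word is empty with value
      \<open>x\<close>, which by the fixed point equation is also the value at its start.\<close>
    have "X (Suc k) = cfrac_tail (drop (Suc (k mod length us)) us) x"
      by (simp add: X_def mod_Suc x(2))
    then show ?thesis
      by (simp add: X_def Cons_nth_drop_Suc[OF lt, symmetric])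
  qed
  have "(\<lambda>k. cfrac_val (map (\<lambda>i. us ! (i mod length us)) [0..<Suc k])) \<longlonglongrightarrow> X 0"
    by (rule cfrac_val_convergents[where u = "\<lambda>i. us ! (i mod length us)", OF _ _ rec])
      (use ne pos in \<open>auto simp: X_def intro!: cfrac_tail_pos x(1)\<close>)
  then show ?thesis
    using ne pos x(2) by (simp add: has_periodic_cfrac_def X_def)
qed

text \<open>Lets the fixed point equation, cleared of denominators, be checked on the matrix of the
  word with its zeros still present.\<close>

lemma has_periodic_cfrac_absorb_zeros:
  assumes us: "us \<noteq> []" "0 < hd us" "0 < last us" and mat: "cfrac_mat us = (p, q, r, s)"
    and x: "0 < x" "of_int r * x\<^sup>2 + of_int s * x = of_int p * x + of_int q"
  shows "has_periodic_cfrac x (absorb_zeros us)"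
proof (rule has_periodic_cfrac_fixpoint)
  show "cfrac_tail (absorb_zeros us) x = x"
  proof -
    have "of_int p * x + of_int q = x * (of_int r * x + of_int s)"
      using x(2) by (simp add: algebra_simps power2_eq_square)
    then show ?thesis
      using cfrac_tail_eq_mat[OF mat x(1)] by (simp add: cfrac_tail_absorb_zeros)
  qed
qed (use us x(1) absorb_zeros_pos in auto)

section \<open>The two periods\<close>

text \<open>The second column of the matrix of \<open>us\<close> enters only through
  \<open>d\<close>, which cancels in the difference of the diagonal entries. The fixed point
  equation is twice the quadratic with \<open>e = d\<close>.\<close>

lemma cfrac_mat_period1:
  assumes "us \<noteq> []" "0 < hd us" "0 < last us" "cfrac_mat us = (c, c', a, a')"
    and "c * a' - c' * a = d"
  shows "cfrac_mat (period1 us) =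
    (4 * c\<^sup>2 - 2 * c * a - d, 4 * c * a - 2 * d - 2 * a\<^sup>2, 2 * c\<^sup>2, 2 * c * a - d)"
proof -
  have "cfrac_mat (dec_first us) = mult2 (1, - 1, 0, 1) (c, c', a, a')"
    "cfrac_mat (dec_first (rev us)) = mult2 (1, - 1, 0, 1) (c, a, c', a')"
    using assms by (simp_all add: cfrac_mat_dec_first hd_rev cfrac_mat_rev)
  then show ?thesis
    using assms(5)[symmetric]
    by (simp add: period1_def cfrac_mat_append algebra_simps power2_eq_square)
qed

text \<open>Here the second pair 1, 1 follows the lowered entry, which transposes the middle factor
  and flips the sign of \<open>d\<close>.\<close>

lemma cfrac_mat_period2:
  assumes "us \<noteq> []" "0 < hd us" "0 < last us" "us \<noteq> [1]" "cfrac_mat us = (c, c', a, a')"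
    and "c * a' - c' * a = d"
  shows "cfrac_mat (period2 us) =
    (4 * c\<^sup>2 - 2 * c * a + d, 4 * c * a + 2 * d - 2 * a\<^sup>2, 2 * c\<^sup>2, 2 * c * a + d)"
proof -
  \<comment> \<open>Ensures that the subtraction in \<open>dec_last\<close> does not truncate; for
    \<open>[1]\<close> it would.\<close>
  have "0 < last (dec_first us)"
    using assms(1-4) by (cases us) (auto simp: dec_first_def)
  moreover have "dec_first us \<noteq> []" by (simp add: dec_first_def)
  ultimately have
    "cfrac_mat (dec_last (dec_first us)) =
       mult2 (mult2 (1, - 1, 0, 1) (c, c', a, a')) (1, 0, - 1, 1)"
    "cfrac_mat (rev us) = (c, a, c', a')"
    using assms by (simp_all add: cfrac_mat_dec_last cfrac_mat_dec_first cfrac_mat_rev)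
  then show ?thesis
    using assms(6)[symmetric]
    by (simp add: period2_def cfrac_mat_append algebra_simps power2_eq_square)
qed

theorem mainTheorem4:
  fixes a b c \<delta> :: nat and as :: "nat list"
  assumes "0 < a" and "0 < b" and "0 < c" and "0 < \<delta>"
    and "(int c)\<^sup>2 - int \<delta> * (int b)\<^sup>2 = 1 \<or> (int c)\<^sup>2 - int \<delta> * (int b)\<^sup>2 = -1"
    and "coprime a c" and "a < c"
    and "as \<noteq> []" and "\<forall>x \<in> set as. 0 < x"
    and "real a / real c = cfrac_val (0 # as)"
  shows "has_periodic_cfrac ((real c - real a + real b * sqrt (real \<delta>)) / real c)
           (absorb_zeros (period1 as)) \<or>
         has_periodic_cfrac ((real c - real a + real b * sqrt (real \<delta>)) / real c)
           (absorb_zeros (period2 as))"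
proof -
  define x where "x = (real c - real a + real b * sqrt (real \<delta>)) / real c"
  define e where "e = (int c)\<^sup>2 - int \<delta> * (int b)\<^sup>2"
  obtain p q r s where m: "cfrac_mat as = (p, q, r, s)"
    by (metis prod_cases4)
  have pr: "0 < p" "0 < r" "cfrac_val as = of_int p / of_int r"
    using cfrac_val_eq_mat[OF assms(8,9) m] by auto
  have det: "p * s - q * r = (- 1) ^ length as"
    using det2_cfrac_mat[of as] m by simp
  define d where "d = p * s - q * r"
  have d: "d = 1 \<or> d = - 1"
    unfolding d_def det by (cases "even (length as)") auto
  have "coprime p r"
  proof (rule coprimeI)
    fix k assume "k dvd p" "k dvd r"
    then have "k dvd d" unfolding d_def by (intro dvd_diff dvd_mult dvd_mult2)
    then show "is_unit k" using d by auto
  qed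
  have "cfrac_val (0 # as) = of_int r / of_int p"
    using assms(8) pr by (cases as) auto
  then have "real_of_int (int a * p) = of_int (r * int c)"
    using assms(3,10) pr by (simp add: field_simps)
  then have "int a * p = r * int c" by linarith
  \<comment> \<open>Two reduced fractions with positive terms agree only termwise.\<close>
  then have "int a = r \<and> int c = p"
    using coprime_crossproduct_int[of "int a" "int c" r p] assms(6) \<open>coprime p r\<close> pr
    by (simp add: coprime_commute mult.commute)
  then have m: "cfrac_mat as = (int c, q, int a, s)" and dd: "int c * s - q * int a = d"
    using m by (auto simp: d_def)
  have ends: "0 < hd as" "0 < last as"
    using assms(8,9) by auto
  have "as \<noteq> [1]"
    using assms(3,7,10) by auto
  have "0 < x"
    unfolding x_def using assms(1,3,7) by (intro divide_pos_pos add_pos_nonneg) auto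
  have "real c * x - (real c - real a) = real b * sqrt (real \<delta>)"
    unfolding x_def using assms(3) by simp
  \<comment> \<open>Squaring removes the root, and the Pell equation replaces
    \<open>\<delta>\<close> and \<open>b\<close> by \<open>c\<close> and \<open>e\<close>.\<close>
  then have "(real c * x - (real c - real a))\<^sup>2 = (real c)\<^sup>2 - of_int e"
    by (simp add: power_mult_distrib e_def)
  then have quad: "(real c)\<^sup>2 * x\<^sup>2 = 2 * real c * (real c - real a) * x
      - (real a)\<^sup>2 + 2 * real a * real c - of_int e"
    by (simp add: algebra_simps power2_eq_square)
  have "e = d \<or> e = - d"
    using assms(5) d by (auto simp: e_def)
  then show ?thesis
  proof
    assume [simp]: "e = d"
    have "has_periodic_cfrac x (absorb_zeros (period1 as))"
    proof (rule has_periodic_cfrac_absorb_zeros[OF _ _ _ cfrac_mat_period1[OF assms(8) ends m dd]])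
      obtain v vs where as: "as = v # vs" using assms(8) by (cases as) auto
      \<comment> \<open>The last entry is the first entry of \<open>as\<close>, lowered by 1 if
        \<open>as\<close> has length 1.\<close>
      show "0 < last (period1 as)"
        using as ends \<open>as \<noteq> [1]\<close>
        by (cases vs rule: rev_cases) (auto simp: period1_def dec_first_def)
    qed (use \<open>0 < x\<close> quad in \<open>auto simp: period1_def algebra_simps power2_eq_square\<close>)
    then show ?thesis by (simp add: x_def)
  next
    assume [simp]: "e = - d"
    have "has_periodic_cfrac x (absorb_zeros (period2 as))"
    proof (rule has_periodic_cfrac_absorb_zeros[OF _ _ _
          cfrac_mat_period2[OF assms(8) ends \<open>as \<noteq> [1]\<close> m dd]])
      show "0 < last (period2 as)"
        using assms(8) ends by (simp add: period2_def last_rev)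
    qed (use \<open>0 < x\<close> quad in \<open>auto simp: period2_def algebra_simps power2_eq_square\<close>)
    then show ?thesis by (simp add: x_def)
  qed
qed

end
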